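(* Let $\mathcal{I}$ be an ideal on $\omega$. Then $$\mathrm{SL}(\mathcal{I})=\overline{\mathrm{co}}(\{f_{\mathcal{F}}:\mathcal{F}\in\mathrm{Ult}(\mathcal{I})\}),$$ where $\overline{\mathrm{co}}(Y)$ denotes the weak$^\star$ closed convex hull of a set $Y$ in the norm dual $\ell_\infty^{\,\prime}$ of $\ell_\infty$.
   Context: $\omega$ is the set of nonnegative integers. An ideal on $\omega$ is a family $\mathcal{I}\subseteq\mathcal{P}(\omega)$ closed under finite unions and subsets, with $\omega\notin\mathcal{I}$ and containing all finite subsets of $\omega$. $\ell_\infty$ is the Banach lattice of bounded real sequences with the supremum norm and pointwise order; $c$ is the space of convergent real sequences; $\bm{1}_A$ is the characteristic sequence of $A\subseteq\omega$. $\mathrm{SL}(\mathcal{I})$ is the set of linear functionals $f:\ell_\infty\to\mathbf{R}$ such that: (i) $f(x)\ge 0$ whenever $x\ge 0$; (ii) $f(x)=\lim x$ for all $x\in c$; (iii) $f(\bm{1}_A)=0$ for all $A\in\mathcal{I}$. (Such functionals are automatically continuous.) $\mathrm{Ult}(\mathcal{I})$ is the set of ultrafilters $\mathcal{F}$ on $\omega$ with $\omega\setminus A\in\mathcal{F}$ for all $A\in\mathcal{I}$. For an ultrafilter $\mathcal{F}$ on $\omega$ and $x\in\ell_\infty$, $f_{\mathcal{F}}(x):=\mathcal{F}\text{-}\lim x$ is the unique $\eta\in\mathbf{R}$ with $\{n:|x_n-\eta|<\varepsilon\}\in\mathcal{F}$ for all $\varepsilon>0$. *)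

theory Defs
  imports "HOL-Analysis.Analysis"
begin

definition ideal_on_nat :: "nat set set \<Rightarrow> bool" where
  "ideal_on_nat I \<longleftrightarrow>
     (\<forall>A\<in>I. \<forall>B\<in>I. A \<union> B \<in> I) \<and>
     (\<forall>A\<in>I. \<forall>B. B \<subseteq> A \<longrightarrow> B \<in> I) \<and>
     UNIV \<notin> I \<and>
     (\<forall>A. finite A \<longrightarrow> A \<in> I)"

text \<open>The topology of \<^typ>\<open>nat\<close> is discrete, so bounded continuous functions on it
  are just bounded sequences, and the norm of this type is the supremum norm.\<close>
type_synonym linf = "nat \<Rightarrow>\<^sub>C real"

definition char_seq :: "nat set \<Rightarrow> linf" where
  "char_seq A = Bcontfun (indicator A)"

lemma char_seq_apply: "apply_bcontfun (char_seq A) = indicator A"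
proof -
  have "bounded (range (indicator A :: nat \<Rightarrow> real))"
    by (rule boundedI[of _ 1]) (auto simp: indicator_def)
  then show ?thesis
    by (simp add: char_seq_def Bcontfun_inverse bcontfun_def)
qed

text \<open>Continuity of the functionals is not part of the definition.\<close>
definition SL :: "nat set set \<Rightarrow> (linf \<Rightarrow> real) set" where
  "SL I = {f. linear f \<and>
     (\<forall>x. (\<forall>n. 0 \<le> apply_bcontfun x n) \<longrightarrow> 0 \<le> f x) \<and>
     (\<forall>x. convergent (apply_bcontfun x) \<longrightarrow> f x = lim (apply_bcontfun x)) \<and>
     (\<forall>A\<in>I. f (char_seq A) = 0)}"

text \<open>A set \<open>A\<close> belongs to the filter \<open>F\<close> iff \<open>\<forall>\<^sub>F n in F. n \<in> A\<close>; the type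
  \<open>nat filter\<close> also contains the improper filter \<^term>\<open>bot\<close>.\<close>
definition ultrafilter :: "nat filter \<Rightarrow> bool" where
  "ultrafilter F \<longleftrightarrow> F \<noteq> bot \<and>
     (\<forall>A. (\<forall>\<^sub>F n in F. n \<in> A) \<or> (\<forall>\<^sub>F n in F. n \<in> - A))"

definition Ult :: "nat set set \<Rightarrow> nat filter set" where
  "Ult I = {F. ultrafilter F \<and> (\<forall>A\<in>I. \<forall>\<^sub>F n in F. n \<in> - A)}"

lemma ultrafilter_tendsto_Lim:
  fixes x :: linf
  assumes "ultrafilter F"
  shows "(apply_bcontfun x \<longlongrightarrow> Lim F (apply_bcontfun x)) F"
proof -
  have nb: "F \<noteq> bot" and dich: "\<And>A. (\<forall>\<^sub>F n in F. n \<in> A) \<or> (\<forall>\<^sub>F n in F. n \<in> - A)"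
    using assms by (auto simp: ultrafilter_def)
  let ?G = "filtermap (apply_bcontfun x) F"
  have "compact (closure (range (apply_bcontfun x)))"
    by simp
  moreover have "?G \<noteq> bot"
    using nb by (simp add: filtermap_bot_iff)
  moreover have "\<forall>\<^sub>F y in ?G. y \<in> closure (range (apply_bcontfun x))"
    by (simp add: eventually_filtermap closure_subset[THEN subsetD])
  ultimately obtain l where l: "inf (nhds l) ?G \<noteq> bot"
    unfolding compact_filter by blast
  have "(apply_bcontfun x \<longlongrightarrow> l) F"
  proof (rule topological_tendstoI)
    fix S assume S: "open S" "l \<in> S"
    show "\<forall>\<^sub>F n in F. apply_bcontfun x n \<in> S"
    proof (rule ccontr)
      assume "\<not> (\<forall>\<^sub>F n in F. apply_bcontfun x n \<in> S)"
      then have "\<forall>\<^sub>F n in F. apply_bcontfun x n \<notin> S"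
        using dich[of "{n. apply_bcontfun x n \<in> S}"] by simp
      then have "\<forall>\<^sub>F y in ?G. y \<notin> S"
        by (simp add: eventually_filtermap)
      moreover have "\<forall>\<^sub>F y in nhds l. y \<in> S"
        using S by (simp add: eventually_nhds_in_open)
      ultimately have "\<forall>\<^sub>F y in inf (nhds l) ?G. False"
        unfolding eventually_inf by blast
      then show False
        using l by (simp add: trivial_limit_def)
    qed
  qed
  then show ?thesis
    using tendsto_Lim[OF nb] by metis
qed

lemma bounded_linear_ultrafilter_Lim:
  assumes "ultrafilter F"
  shows "bounded_linear (\<lambda>x :: linf. Lim F (apply_bcontfun x))"
proof -
  have nb: "F \<noteq> bot"
    using assms by (simp add: ultrafilter_def)
  note T = ultrafilter_tendsto_Lim[OF assms]
  show ?thesis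
  proof (rule bounded_linear_intro[where K = 1])
    fix x y :: linf
    show "Lim F (apply_bcontfun (x + y)) = Lim F (apply_bcontfun x) + Lim F (apply_bcontfun y)"
      using tendsto_Lim[OF nb tendsto_add[OF T[of x] T[of y]]]
      by (simp add: plus_bcontfun.rep_eq)
  next
    fix r :: real and x :: linf
    show "Lim F (apply_bcontfun (r *\<^sub>R x)) = r *\<^sub>R Lim F (apply_bcontfun x)"
      using tendsto_Lim[OF nb tendsto_scaleR[OF tendsto_const T[of x]], of r]
      by (simp add: scaleR_bcontfun.rep_eq)
  next
    fix x :: linf
    show "norm (Lim F (apply_bcontfun x)) \<le> norm x * 1"
      using tendsto_upperbound[OF tendsto_norm[OF T[of x]] _ nb, of "norm x"]
        norm_bounded[of x] by simp
  qed
qed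

text \<open>The functional \<open>f\<^sub>F\<close>, as an element of the norm dual; by the lemma above it
  is well defined whenever \<open>F\<close> is an ultrafilter.\<close>
definition ult_lim :: "nat filter \<Rightarrow> linf \<Rightarrow>\<^sub>L real" where
  "ult_lim F = Blinfun (\<lambda>x. Lim F (apply_bcontfun x))"

lemma ult_lim_apply:
  "ultrafilter F \<Longrightarrow> blinfun_apply (ult_lim F) x = Lim F (apply_bcontfun x)"
  by (simp add: ult_lim_def bounded_linear_Blinfun_apply bounded_linear_ultrafilter_Lim)

text \<open>For real-valued functionals the strong operator topology, i.e. the topology of
  pointwise convergence, is the weak-star topology.\<close>
definition weak_star_closed_convex_hull ::
    "('a::real_normed_vector \<Rightarrow>\<^sub>L real) set \<Rightarrow> ('a \<Rightarrow>\<^sub>L real) set" where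
  "weak_star_closed_convex_hull Y = strong_operator_topology closure_of (convex hull Y)"

end

theory Submission
  imports Defs
begin

text \<open>
  The functionals in \<open>SL(\<I>)\<close> are the finitely additive probabilities on \<open>\<omega>\<close> that vanish on
  \<open>\<I>\<close>, and those given by ultrafilters are the two-valued ones.  The inclusion of the closed
  convex hull in \<open>SL(\<I>)\<close> holds because each ultrafilter limit lies in \<open>SL(\<I>)\<close> and all
  conditions defining \<open>SL(\<I>)\<close> are convex and closed under pointwise limits.

  For the other inclusion there is a direct argument without separation theorems.  A weak-star
  neighbourhood of \<open>f\<close> in \<open>SL(\<I>)\<close> only tests finitely many bounded sequences, up to some
  \<open>\<epsilon> > 0\<close>.  Rounding their values down to multiples of \<open>\<epsilon>\<close> splits \<open>\<omega>\<close> into finitely many cells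
  \<open>A\<^sub>1, \<dots>, A\<^sub>m\<close> on each of which all tested sequences oscillate by at most \<open>\<epsilon>\<close>
  (\<open>finite_range_rounding_code\<close>).  Each cell outside \<open>\<I>\<close> belongs to some ultrafilter \<open>F\<^sub>j\<close>
  in \<open>Ult(\<I>)\<close> (\<open>Ult_containing_set\<close>, by Zorn's lemma), while the cells in \<open>\<I>\<close> have
  \<open>f\<close>-measure zero.  Hence the numbers \<open>f(1\<^bsub>A\<^sub>j\<^esub>)\<close>, taken over the cells outside \<open>\<I>\<close>, are convex
  weights, and the convex combination of the limits along \<open>F\<^sub>j\<close> with these weights agrees with
  \<open>f\<close> on the tested sequences up to \<open>2\<epsilon>\<close> (\<open>SL_finite_approximation\<close>).
\<close>

section \<open>Ultrafilters that avoid an ideal\<close>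

text \<open>Zorn's lemma applied to the proper filters finer than \<open>F\<close>.  A minimal one \<open>U\<close> decides every
  set: if \<open>-A\<close> is not in \<open>U\<close>, adding \<open>A\<close> to \<open>U\<close> gives a proper filter, which must be \<open>U\<close>.\<close>
lemma ultrafilter_below:
  assumes "F \<noteq> bot"
  shows "\<exists>U\<le>F. ultrafilter U"
proof -
  let ?S = "{G. G \<le> F \<and> G \<noteq> bot}"
  have "\<exists>U\<in>?S. \<forall>G\<in>?S. U \<ge> G \<longrightarrow> G = U"
  proof (rule predicate_Zorn)
    show "partial_order_on ?S (relation_of (\<ge>) ?S)"
      by (auto simp: partial_order_on_def preorder_on_def refl_on_def trans_def antisym_def
          relation_of_def)
  next
    fix C assume C: "C \<in> Chains (relation_of (\<ge>) ?S)"
    then have sub: "C \<subseteq> ?S"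
      by (rule Chains_relation_of)
    show "\<exists>u\<in>?S. \<forall>a\<in>C. a \<ge> u"
    proof (cases "C = {}")
      case True
      then show ?thesis using assms by auto
    next
      case False
      have dir: "\<exists>x\<in>C. x \<le> inf G H" if "G \<in> C" "H \<in> C" for G H
        using C that by (auto simp: Chains_def relation_of_def)
      have "eventually P (Inf C) \<longleftrightarrow> (\<exists>G\<in>C. eventually P G)" for P
        by (rule eventually_Inf_base[OF False dir])
      then have "Inf C \<noteq> bot"
        using sub by (auto simp: trivial_limit_def)
      moreover have "Inf C \<le> F"
        using False sub by (metis (no_types, lifting) Inf_lower2 all_not_in_conv
            mem_Collect_eq subsetD)
      ultimately show ?thesis
        by (auto intro: Inf_lower)
    qed
  qed
  then obtain U where U: "U \<le> F" "U \<noteq> bot"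
    and min: "\<And>G. G \<le> U \<Longrightarrow> G \<noteq> bot \<Longrightarrow> G = U"
    by (metis (mono_tags, lifting) mem_Collect_eq order.trans)
  have "(\<forall>\<^sub>F n in U. n \<in> A) \<or> (\<forall>\<^sub>F n in U. n \<in> - A)" for A
  proof (cases "inf U (principal A) = bot")
    case True
    then show ?thesis
      by (simp add: trivial_limit_def eventually_inf_principal)
  next
    case False
    then have "inf U (principal A) = U"
      by (intro min) auto
    then have "U \<le> principal A"
      by (metis inf.cobounded2)
    then show ?thesis
      by (simp add: le_principal)
  qed
  with U show ?thesis
    by (auto simp: ultrafilter_def)
qed

text \<open>The sets whose complement relative to \<open>A\<close> lies in \<open>I\<close> form a filter, which contains \<open>A\<close>
  and all complements of members of \<open>I\<close>; it is proper exactly because \<open>A\<close> is not in \<open>I\<close>.\<close>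
lemma Ult_containing_set:
  assumes "ideal_on_nat I" and "A \<notin> I"
  shows "\<exists>F\<in>Ult I. \<forall>\<^sub>F n in F. n \<in> A"
proof -
  have un: "\<And>B C. B \<in> I \<Longrightarrow> C \<in> I \<Longrightarrow> B \<union> C \<in> I" and down: "\<And>B C. B \<in> I \<Longrightarrow> C \<subseteq> B \<Longrightarrow> C \<in> I"
    and empty: "{} \<in> I"
    using assms(1) by (auto simp: ideal_on_nat_def)
  define G where "G = Abs_filter (\<lambda>P. {n\<in>A. \<not> P n} \<in> I)"
  have "is_filter (\<lambda>P. {n\<in>A. \<not> P n} \<in> I)"
  proof
    show "{n\<in>A. \<not> True} \<in> I" using empty by simp
  next
    fix P Q assume "{n\<in>A. \<not> P n} \<in> I" "{n\<in>A. \<not> Q n} \<in> I"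
    then have "{n\<in>A. \<not> P n} \<union> {n\<in>A. \<not> Q n} \<in> I" by (rule un)
    then show "{n\<in>A. \<not> (P n \<and> Q n)} \<in> I" by (rule down) auto
  next
    fix P Q :: "nat \<Rightarrow> bool" assume "\<forall>x. P x \<longrightarrow> Q x" "{n\<in>A. \<not> P n} \<in> I"
    then show "{n\<in>A. \<not> Q n} \<in> I" by (auto elim: down)
  qed
  then have ev: "eventually P G \<longleftrightarrow> {n\<in>A. \<not> P n} \<in> I" for P
    by (simp add: G_def eventually_Abs_filter)
  have "G \<noteq> bot"
    using assms(2) by (simp add: trivial_limit_def ev)
  then obtain U where U: "U \<le> G" "ultrafilter U"
    using ultrafilter_below by blast
  have "\<forall>\<^sub>F n in U. n \<in> - B" if "B \<in> I" for B
    using that by (intro filter_leD[OF U(1)]) (auto simp: ev elim: down)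
  moreover have "\<forall>\<^sub>F n in U. n \<in> A"
    by (intro filter_leD[OF U(1)]) (simp add: ev empty)
  ultimately show ?thesis
    using U(2) by (auto simp: Ult_def)
qed

section \<open>The functionals in \<open>SL\<close>\<close>

lemma linear_blinfun_apply: "linear (blinfun_apply g)"
  by (simp add: blinfun.bounded_linear_right bounded_linear.linear)

lemma SL_linear: "f \<in> SL I \<Longrightarrow> linear f"
  and SL_nonneg: "f \<in> SL I \<Longrightarrow> (\<And>n. 0 \<le> apply_bcontfun x n) \<Longrightarrow> 0 \<le> f x"
  and SL_convergent: "f \<in> SL I \<Longrightarrow> convergent (apply_bcontfun x) \<Longrightarrow> f x = lim (apply_bcontfun x)"
  and SL_ideal: "f \<in> SL I \<Longrightarrow> A \<in> I \<Longrightarrow> f (char_seq A) = 0"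
  by (auto simp: SL_def)

lemma SL_const: "f \<in> SL I \<Longrightarrow> f (const_bcontfun c) = c"
  using SL_convergent[of f I "const_bcontfun c"] by (simp add: convergent_const)

text \<open>Positivity applied to \<open>e - x\<close> and \<open>x + e\<close>; with \<open>e = norm x\<close> this yields the automatic
  continuity of the functionals.\<close>
lemma SL_abs_le:
  assumes f: "f \<in> SL I" and x: "\<And>n. \<bar>apply_bcontfun x n\<bar> \<le> e"
  shows "\<bar>f x\<bar> \<le> e"
proof -
  note lin = SL_linear[OF f]
  have "0 \<le> apply_bcontfun (const_bcontfun e - x) n"
    "0 \<le> apply_bcontfun (x - const_bcontfun (- e)) n" for n
    using x[of n] unfolding minus_bcontfun.rep_eq const_bcontfun.rep_eq by linarith+
  then have "0 \<le> f (const_bcontfun e - x)" "0 \<le> f (x - const_bcontfun (- e))"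
    by (blast intro: SL_nonneg[OF f])+
  then show ?thesis
    by (simp add: linear_diff[OF lin] SL_const[OF f])
qed

lemma SL_bounded_linear:
  assumes f: "f \<in> SL I"
  shows "bounded_linear f"
proof (rule bounded_linear_intro[where K = 1])
  show "norm (f x) \<le> norm x * 1" for x
    using SL_abs_le[OF f, of x "norm x"] norm_bounded[of x] by simp
qed (simp_all add: linear_add linear_scale SL_linear[OF f])

text \<open>Finite sets belong to \<open>I\<close>, so an ultrafilter in \<open>Ult I\<close> refines the filter of cofinite
  sets; this is why its limit extends the ordinary one.\<close>
lemma ult_lim_in_SL:
  assumes I: "ideal_on_nat I" and F: "F \<in> Ult I"
  shows "blinfun_apply (ult_lim F) \<in> SL I"
proof -
  have uf: "ultrafilter F" and av: "\<And>A. A \<in> I \<Longrightarrow> \<forall>\<^sub>F n in F. n \<in> - A"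
    using F by (auto simp: Ult_def)
  have nb: "F \<noteq> bot"
    using uf by (simp add: ultrafilter_def)
  note T = ultrafilter_tendsto_Lim[OF uf]
  have "F \<le> sequentially"
  proof (rule filter_leI)
    fix P :: "nat \<Rightarrow> bool" assume "eventually P sequentially"
    then obtain N where N: "\<And>n. n \<ge> N \<Longrightarrow> P n"
      by (auto simp: eventually_sequentially)
    have "\<forall>\<^sub>F n in F. n \<in> - {..<N}"
      using I by (intro av) (simp add: ideal_on_nat_def)
    then show "eventually P F"
      by eventually_elim (simp add: N)
  qed
  then have "Lim F (apply_bcontfun x) = lim (apply_bcontfun x)"
    if "convergent (apply_bcontfun x)" for x :: linf
    using that tendsto_Lim[OF nb tendsto_mono] by (auto simp: convergent_LIMSEQ_iff)
  moreover have "0 \<le> Lim F (apply_bcontfun x)" if "\<forall>n. 0 \<le> apply_bcontfun x n" for x :: linf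
    using tendsto_lowerbound[OF T[of x] _ nb, of 0] that by simp
  moreover have "Lim F (apply_bcontfun (char_seq A)) = 0" if "A \<in> I" for A
  proof (rule tendsto_Lim[OF nb tendsto_eventually])
    show "\<forall>\<^sub>F n in F. apply_bcontfun (char_seq A) n = 0"
      using av[OF that] by eventually_elim (simp add: char_seq_apply)
  qed
  ultimately show ?thesis
    by (simp add: SL_def ult_lim_apply[OF uf] linear_blinfun_apply)
qed

lemma convex_SL: "convex {g :: linf \<Rightarrow>\<^sub>L real. blinfun_apply g \<in> SL I}"
proof (rule convexI)
  fix g h :: "linf \<Rightarrow>\<^sub>L real" and u v :: real
  assume "g \<in> {g. blinfun_apply g \<in> SL I}" "h \<in> {g. blinfun_apply g \<in> SL I}"
    and uv: "0 \<le> u" "0 \<le> v" "u + v = 1"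
  then have g: "blinfun_apply g \<in> SL I" and h: "blinfun_apply h \<in> SL I"
    by auto
  let ?q = "u *\<^sub>R g + v *\<^sub>R h"
  have q: "?q x = u * g x + v * h x" for x
    by (simp add: blinfun.add_left blinfun.scaleR_left)
  have "0 \<le> ?q x" if "\<forall>n. 0 \<le> apply_bcontfun x n" for x
    unfolding q using SL_nonneg[OF g, of x] SL_nonneg[OF h, of x] uv that by simp
  moreover have "?q x = lim (apply_bcontfun x)" if "convergent (apply_bcontfun x)" for x
    unfolding q SL_convergent[OF g that] SL_convergent[OF h that] distrib_right[symmetric] uv
    by simp
  moreover have "?q (char_seq A) = 0" if "A \<in> I" for A
    unfolding q SL_ideal[OF g that] SL_ideal[OF h that] by simp
  ultimately show "?q \<in> {g. blinfun_apply g \<in> SL I}"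
    unfolding SL_def mem_Collect_eq by (intro conjI linear_blinfun_apply) simp_all
qed

section \<open>The weak-star closure\<close>

lemma strong_operator_closure_iff:
  fixes g :: "'a::real_normed_vector \<Rightarrow>\<^sub>L 'b::real_normed_vector"
  shows "g \<in> strong_operator_topology closure_of S \<longleftrightarrow>
    (\<forall>X e. finite X \<longrightarrow> 0 < e \<longrightarrow> (\<exists>h\<in>S. \<forall>x\<in>X. dist (h x) (g x) < e))"
    (is "?L \<longleftrightarrow> ?R")
proof
  assume L: ?L
  show ?R
  proof (intro allI impI)
    fix X :: "'a set" and e :: real assume "finite X" "0 < e"
    then have "openin strong_operator_topology {h. \<forall>x\<in>X. blinfun_apply h x \<in> ball (g x) e}"
      (is "openin _ ?T")
      using strong_operator_topology_basis[of X "\<lambda>x. ball (g x) e" "\<lambda>x. x"] by simp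
    moreover have "g \<in> ?T"
      using \<open>0 < e\<close> by simp
    ultimately have "\<exists>h. h \<in> S \<and> h \<in> ?T"
      using L[unfolded in_closure_of, THEN conjunct2, rule_format, of ?T] by simp
    then show "\<exists>h\<in>S. \<forall>x\<in>X. dist (h x) (g x) < e"
      by (auto simp: dist_commute)
  qed
next
  assume R: ?R
  show ?L
    unfolding in_closure_of
  proof (intro conjI allI impI; (elim conjE)?)
    fix T assume "g \<in> T" "openin strong_operator_topology T"
    then obtain U where "open U" "T = blinfun_apply -` U"
      by (auto simp: strong_operator_topology_def openin_pullback_topology)
    with \<open>g \<in> T\<close> have "openin (product_topology (\<lambda>_. euclidean) UNIV) U" "blinfun_apply g \<in> U"
      by (auto simp: euclidean_product_topology)
    from product_topology_open_contains_basis[OF this] obtain V :: "'a \<Rightarrow> 'b set"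
      where V: "\<And>x. g x \<in> V x" "\<And>x. open (V x)" "finite {x. V x \<noteq> UNIV}"
        "(\<Pi>\<^sub>E x\<in>UNIV. V x) \<subseteq> U"
      by (auto simp: PiE_iff)
    have "\<exists>d>0. ball (g x) d \<subseteq> V x" for x
      using V(1,2) open_contains_ball by blast
    then obtain d where d: "\<And>x. 0 < d x" "\<And>x. ball (g x) (d x) \<subseteq> V x"
      by metis
    let ?X = "{x. V x \<noteq> UNIV}"
    \<comment> \<open>the extra 1 keeps the minimum defined when no coordinate is restricted\<close>
    let ?e = "Min (insert 1 (d ` ?X))"
    have "0 < ?e"
      using V(3) d(1) by simp
    then obtain h where h: "h \<in> S" "\<And>x. x \<in> ?X \<Longrightarrow> dist (h x) (g x) < ?e"
      using R[rule_format, OF V(3), of ?e] by auto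
    have "h x \<in> V x" for x
    proof (cases "x \<in> ?X")
      case True
      then have "?e \<le> d x"
        using V(3) by (intro Min_le) auto
      then show ?thesis
        using h(2)[OF True] d(2)[of x] by (auto simp: dist_commute)
    qed simp
    then have "h \<in> T"
      using V(4) \<open>T = _\<close> by (auto simp: PiE_iff)
    with h(1) show "\<exists>y. y \<in> S \<and> y \<in> T" by blast
  qed (simp add: strong_operator_topology_topspace)
qed

text \<open>Each condition in \<open>SL I\<close> is a non-strict inequality or an equation for one value of the
  functional, so it survives approximation of that value.\<close>
lemma closure_SL:
  assumes "\<And>h. h \<in> S \<Longrightarrow> blinfun_apply h \<in> SL I"
    and "g \<in> strong_operator_topology closure_of S"
  shows "blinfun_apply g \<in> SL I"
proof -
  have app: "\<exists>h. blinfun_apply h \<in> SL I \<and> \<bar>h x - g x\<bar> < e" if "0 < e" for x :: linf and e :: real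
    using assms(2)[unfolded strong_operator_closure_iff, rule_format, of "{x}" e] assms(1) that
    by (auto simp: dist_real_def)
  have eq: "g x = c" if "\<And>h. blinfun_apply h \<in> SL I \<Longrightarrow> h x = c" for x c
  proof (rule ccontr)
    assume "g x \<noteq> c"
    then show False
      using app[of "\<bar>g x - c\<bar>" x] that by fastforce
  qed
  have "0 \<le> g x" if x: "\<forall>n. 0 \<le> apply_bcontfun x n" for x
  proof (rule ccontr)
    assume "\<not> 0 \<le> g x"
    then obtain h :: "linf \<Rightarrow>\<^sub>L real" where "blinfun_apply h \<in> SL I" "\<bar>h x - g x\<bar> < - g x"
      using app[of "- g x" x] by auto
    with SL_nonneg[of h I x] x show False by auto
  qed
  moreover have "g x = lim (apply_bcontfun x)" if "convergent (apply_bcontfun x)" for x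
    by (rule eq) (rule SL_convergent[OF _ that])
  moreover have "g (char_seq A) = 0" if "A \<in> I" for A
    by (rule eq) (rule SL_ideal[OF _ that])
  ultimately show ?thesis
    unfolding SL_def mem_Collect_eq by (intro conjI linear_blinfun_apply) simp_all
qed

section \<open>Approximation by finite convex combinations\<close>

text \<open>The code of \<open>n\<close> records the rounded values at \<open>n\<close> of all the tested sequences; its fibres
  are the cells of the partition.\<close>
lemma finite_range_rounding_code:
  fixes X :: "linf set" and e :: real
  assumes "finite X"
  shows "finite (range (\<lambda>n. \<lambda>x\<in>X. \<lfloor>apply_bcontfun x n / e\<rfloor>))"
proof (rule finite_subset)
  let ?K = "\<lambda>x::linf. {\<lfloor>- (norm x / \<bar>e\<bar>)\<rfloor> .. \<lfloor>norm x / \<bar>e\<bar>\<rfloor>}"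
  show "finite (PiE X ?K)"
    using assms by (intro finite_PiE) auto
  have "\<lfloor>apply_bcontfun x n / e\<rfloor> \<in> ?K x" for x :: linf and n
  proof -
    have "\<bar>apply_bcontfun x n / e\<bar> \<le> norm x / \<bar>e\<bar>"
      using norm_bounded[of x n] by (simp add: divide_right_mono)
    then have "- (norm x / \<bar>e\<bar>) \<le> apply_bcontfun x n / e" "apply_bcontfun x n / e \<le> norm x / \<bar>e\<bar>"
      unfolding abs_le_iff by linarith+
    then show ?thesis
      unfolding atLeastAtMost_iff by (intro conjI floor_mono)
  qed
  then show "range (\<lambda>n. \<lambda>x\<in>X. \<lfloor>apply_bcontfun x n / e\<rfloor>) \<subseteq> PiE X ?K"
    by auto
qed

lemma apply_bcontfun_sum_cells:
  assumes "finite (range k)"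
  shows "apply_bcontfun (\<Sum>j\<in>range k. c j *\<^sub>R char_seq (k -` {j})) n = c (k n)"
proof -
  have "apply_bcontfun (sum y J) n = (\<Sum>j\<in>J. apply_bcontfun (y j) n)"
    for y :: "'a \<Rightarrow> linf" and J
    by (induction J rule: infinite_finite_induct) simp_all
  then have "apply_bcontfun (\<Sum>j\<in>range k. c j *\<^sub>R char_seq (k -` {j})) n =
      (\<Sum>j\<in>range k. if k n = j then c j else 0)"
    by (auto simp: char_seq_apply indicator_def intro!: sum.cong)
  then show ?thesis
    using assms by simp
qed

text \<open>Replacing the tested sequences by their rounded versions changes \<open>f\<close> by at most \<open>e\<close>, because
  \<open>f\<close> is positive and normalised.  It also changes each ultrafilter limit, and hence their convex
  combination, by at most \<open>e\<close>, because the ultrafilter chosen for a cell only sees that cell.  On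
  the rounded sequences both functionals equal the same sum over the cells outside \<open>I\<close>.\<close>
lemma SL_finite_approximation:
  assumes I: "ideal_on_nat I" and f: "f \<in> SL I" and X: "finite X" and e: "0 < e"
  shows "\<exists>g\<in>convex hull {ult_lim F | F. F \<in> Ult I}. \<forall>x\<in>X. \<bar>g x - f x\<bar> \<le> 2 * e"
proof -
  note lin = SL_linear[OF f]
  define k where "k n = (\<lambda>x\<in>X. \<lfloor>apply_bcontfun x n / e\<rfloor>)" for n
  define w where "w j = f (char_seq (k -` {j}))" for j
  let ?J = "{j \<in> range k. k -` {j} \<notin> I}"
  have fin: "finite (range k)"
    using finite_range_rounding_code[OF X, of e] by (simp add: k_def[abs_def])
  have w0: "0 \<le> w j" for j
    unfolding w_def by (rule SL_nonneg[OF f]) (simp add: char_seq_apply)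
  have f_cells: "f (\<Sum>j\<in>range k. c j *\<^sub>R char_seq (k -` {j})) = (\<Sum>j\<in>?J. w j * c j)" for c
  proof -
    have "f (\<Sum>j\<in>range k. c j *\<^sub>R char_seq (k -` {j})) = (\<Sum>j\<in>range k. w j * c j)"
      by (simp add: linear_sum[OF lin] linear_scale[OF lin] w_def mult.commute)
    also have "\<dots> = (\<Sum>j\<in>?J. w j * c j)"
      using fin by (intro sum.mono_neutral_right) (auto simp: w_def SL_ideal[OF f])
    finally show ?thesis .
  qed
  have w1: "sum w ?J = 1"
  proof -
    have "(\<Sum>j\<in>range k. 1 *\<^sub>R char_seq (k -` {j})) = const_bcontfun 1"
      by (rule bcontfun_eqI, subst apply_bcontfun_sum_cells[OF fin]) simp
    then show ?thesis
      using f_cells[of "\<lambda>_. 1"] by (simp add: SL_const[OF f])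
  qed
  have "\<forall>j\<in>?J. \<exists>F. F \<in> Ult I \<and> (\<forall>\<^sub>F n in F. n \<in> k -` {j})"
    using Ult_containing_set[OF I] by blast
  from bchoice[OF this] obtain F where F: "\<And>j. j \<in> ?J \<Longrightarrow> F j \<in> Ult I"
    "\<And>j. j \<in> ?J \<Longrightarrow> \<forall>\<^sub>F n in F j. n \<in> k -` {j}"
    by blast
  define g where "g = (\<Sum>j\<in>?J. w j *\<^sub>R ult_lim (F j))"
  have "g \<in> convex hull {ult_lim F | F. F \<in> Ult I}"
    unfolding g_def
  proof (rule convex_sum[OF _ convex_convex_hull w1 w0])
    show "finite ?J" using fin by simp
    show "ult_lim (F j) \<in> convex hull {ult_lim F | F. F \<in> Ult I}" if "j \<in> ?J" for j
      using F(1)[OF that] by (intro hull_inc) blast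
  qed
  moreover have "\<bar>g x - f x\<bar> \<le> 2 * e" if x: "x \<in> X" for x
  proof -
    \<comment> \<open>the value to which \<open>x\<close> is rounded on the cell with code \<open>j\<close>\<close>
    define c where "c j = e * of_int (j x)" for j :: "linf \<Rightarrow> int"
    have close: "\<bar>apply_bcontfun x n - c (k n)\<bar> \<le> e" for n
    proof -
      have "\<bar>apply_bcontfun x n / e - of_int \<lfloor>apply_bcontfun x n / e\<rfloor>\<bar> \<le> 1"
        by linarith
      then have "e * \<bar>apply_bcontfun x n / e - of_int \<lfloor>apply_bcontfun x n / e\<rfloor>\<bar> \<le> e * 1"
        using e by (intro mult_left_mono) auto
      also have "e * \<bar>apply_bcontfun x n / e - of_int \<lfloor>apply_bcontfun x n / e\<rfloor>\<bar>
          = \<bar>e * (apply_bcontfun x n / e - of_int \<lfloor>apply_bcontfun x n / e\<rfloor>)\<bar>"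
        using e by (simp add: abs_mult)
      also have "\<dots> = \<bar>apply_bcontfun x n - c (k n)\<bar>"
        using e x by (simp add: c_def k_def right_diff_distrib)
      finally show ?thesis by simp
    qed
    let ?s = "\<Sum>j\<in>range k. c j *\<^sub>R char_seq (k -` {j})"
    have "\<bar>f (x - ?s)\<bar> \<le> e"
      by (rule SL_abs_le[OF f]) (simp add: apply_bcontfun_sum_cells[OF fin] close)
    then have fx: "\<bar>f x - (\<Sum>j\<in>?J. w j * c j)\<bar> \<le> e"
      by (simp add: linear_diff[OF lin] f_cells)
    have lim: "\<bar>ult_lim (F j) x - c j\<bar> \<le> e" if j: "j \<in> ?J" for j
    proof -
      have uf: "ultrafilter (F j)"
        using F(1)[OF j] by (simp add: Ult_def)
      have "((\<lambda>n. \<bar>apply_bcontfun x n - c j\<bar>) \<longlongrightarrow> \<bar>Lim (F j) (apply_bcontfun x) - c j\<bar>) (F j)"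
        by (intro tendsto_intros ultrafilter_tendsto_Lim uf)
      moreover have "\<forall>\<^sub>F n in F j. \<bar>apply_bcontfun x n - c j\<bar> \<le> e"
        using F(2)[OF j] by eventually_elim (use close in auto)
      ultimately show ?thesis
        using uf by (simp add: ult_lim_apply[OF uf] tendsto_upperbound ultrafilter_def)
    qed
    have "\<bar>g x - (\<Sum>j\<in>?J. w j * c j)\<bar> = \<bar>\<Sum>j\<in>?J. w j * (ult_lim (F j) x - c j)\<bar>"
      by (simp add: g_def blinfun.sum_left blinfun.scaleR_left right_diff_distrib sum_subtractf)
    also have "\<dots> \<le> (\<Sum>j\<in>?J. w j * e)"
      using lim w0
      by (intro order.trans[OF sum_abs] sum_mono) (simp add: abs_mult mult_left_mono)
    also have "\<dots> = e"
      by (simp add: w1 flip: sum_distrib_right)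
    finally show ?thesis
      using fx by linarith
  qed
  ultimately show ?thesis by blast
qed

theorem theorem2p2:
  fixes I :: "nat set set"
  assumes "ideal_on_nat I"
  shows "SL I = blinfun_apply ` weak_star_closed_convex_hull {ult_lim F | F. F \<in> Ult I}"
proof
  let ?Y = "{ult_lim F | F. F \<in> Ult I}"
  have "convex hull ?Y \<subseteq> {g. blinfun_apply g \<in> SL I}"
    using ult_lim_in_SL[OF assms] by (intro hull_minimal convex_SL) auto
  then show "blinfun_apply ` weak_star_closed_convex_hull ?Y \<subseteq> SL I"
    unfolding weak_star_closed_convex_hull_def by (auto intro: closure_SL)
  show "SL I \<subseteq> blinfun_apply ` weak_star_closed_convex_hull ?Y"
  proof
    fix f assume f: "f \<in> SL I"
    then have app: "blinfun_apply (Blinfun f) = f"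
      by (simp add: bounded_linear_Blinfun_apply SL_bounded_linear)
    have "\<exists>h\<in>convex hull ?Y. \<forall>x\<in>X. dist (h x) (f x) < e" if "finite X" "0 < e" for X e
      using SL_finite_approximation[OF assms f that(1), of "e / 3"] that(2)
      by (force simp: dist_real_def)
    then have "Blinfun f \<in> weak_star_closed_convex_hull ?Y"
      unfolding weak_star_closed_convex_hull_def strong_operator_closure_iff app by blast
    then show "f \<in> blinfun_apply ` weak_star_closed_convex_hull ?Y"
      by (rule rev_image_eqI) (simp only: app)
  qed
qed

end
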